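(* Let $S$ be an intra-regular $\Gamma$-AG$^{**}$-groupoid. Then the set of fuzzy $\Gamma$-two-sided ideals of $S$, under the operation $\circ_\Gamma$, forms a semilattice (i.e. a commutative semigroup in which every element is idempotent) with identity $S$.
   Context: Let $S,\Gamma$ be nonempty sets with a map $S\times\Gamma\times S\to S$, $(x,\alpha,y)\mapsto x\alpha y$. $S$ is a $\Gamma$-AG-groupoid if $(x\alpha y)\beta z=(z\alpha y)\beta x$ for all $x,y,z\in S$, $\alpha,\beta\in\Gamma$. It is a $\Gamma$-AG$^{**}$-groupoid if moreover $x\alpha(y\beta z)=y\alpha(x\beta z)$ for all $x,y,z\in S$, $\alpha,\beta\in\Gamma$. $S$ is intra-regular if for every $a\in S$ there exist $x,y\in S$ and $\beta,\gamma,\xi\in\Gamma$ with $a=(x\beta(a\xi a))\gamma y$. A fuzzy subset of $S$ is a function $f:S\to[0,1]$. The symbol $S$, used as a fuzzy subset, denotes the constant function $1$. The $\Gamma$-product of fuzzy subsets $f,g$ is $(f\circ_\Gamma g)(a)=\bigvee_{a=b\alpha c}\{f(b)\wedge g(c)\}$ ($\wedge$ = minimum), the supremum over all $b,c\in S$, $\alpha\in\Gamma$ with $a=b\alpha c$, and $(f\circ_\Gamma g)(a)=0$ if no such $b,c,\alpha$ exist. A fuzzy subset $f$ is a fuzzy $\Gamma$-two-sided ideal if $f(x\alpha y)\ge f(y)$ and $f(x\alpha y)\ge f(x)$ for all $x,y\in S$, $\alpha\in\Gamma$. *)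

theory Defs
  imports "HOL-Algebra.Group" "HOL-Library.FuncSet" Complex_Main
begin

text \<open>The term \<open>m x \<alpha> y\<close> stands for the ternary product \<open>x\<alpha>y\<close>.\<close>

locale gamma_AG_groupoid =
  fixes S :: "'s set" and \<Gamma> :: "'g set" and m :: "'s \<Rightarrow> 'g \<Rightarrow> 's \<Rightarrow> 's"
  assumes S_nonempty: "S \<noteq> {}"
    and Gamma_nonempty: "\<Gamma> \<noteq> {}"
    and m_closed: "\<lbrakk>x \<in> S; \<alpha> \<in> \<Gamma>; y \<in> S\<rbrakk> \<Longrightarrow> m x \<alpha> y \<in> S"
    and left_invertive:
      "\<lbrakk>x \<in> S; y \<in> S; z \<in> S; \<alpha> \<in> \<Gamma>; \<beta> \<in> \<Gamma>\<rbrakk> \<Longrightarrow> m (m x \<alpha> y) \<beta> z = m (m z \<alpha> y) \<beta> x"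

locale gamma_AG_star_star_groupoid = gamma_AG_groupoid S \<Gamma> m
  for S :: "'s set" and \<Gamma> :: "'g set" and m :: "'s \<Rightarrow> 'g \<Rightarrow> 's \<Rightarrow> 's" +
  assumes star_star:
      "\<lbrakk>x \<in> S; y \<in> S; z \<in> S; \<alpha> \<in> \<Gamma>; \<beta> \<in> \<Gamma>\<rbrakk> \<Longrightarrow> m x \<alpha> (m y \<beta> z) = m y \<alpha> (m x \<beta> z)"

definition intra_regular :: "'s set \<Rightarrow> 'g set \<Rightarrow> ('s \<Rightarrow> 'g \<Rightarrow> 's \<Rightarrow> 's) \<Rightarrow> bool" where
  "intra_regular S \<Gamma> m \<longleftrightarrow>
     (\<forall>a\<in>S. \<exists>x\<in>S. \<exists>y\<in>S. \<exists>\<beta>\<in>\<Gamma>. \<exists>\<gamma>\<in>\<Gamma>. \<exists>\<xi>\<in>\<Gamma>. a = m (m x \<beta> (m a \<xi> a)) \<gamma> y)"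

text \<open>Fuzzy subsets are extensional functions (\<open>undefined\<close> outside \<open>S\<close>), so that
  equality in HOL is equality of maps from \<open>S\<close> to the unit interval.\<close>

definition fuzzy_subsets :: "'s set \<Rightarrow> ('s \<Rightarrow> real) set" where
  "fuzzy_subsets S = S \<rightarrow>\<^sub>E {0..1}"

definition fuzzy_whole :: "'s set \<Rightarrow> 's \<Rightarrow> real" where
  "fuzzy_whole S = (\<lambda>x\<in>S. 1)"

text \<open>The empty case is separate because \<open>Sup {}\<close> is unspecified on the reals. For fuzzy
  subsets the set is bounded by 1, so the supremum below is genuine.\<close>

definition gamma_product ::
  "'s set \<Rightarrow> 'g set \<Rightarrow> ('s \<Rightarrow> 'g \<Rightarrow> 's \<Rightarrow> 's) \<Rightarrow> ('s \<Rightarrow> real) \<Rightarrow> ('s \<Rightarrow> real) \<Rightarrow> 's \<Rightarrow> real" where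
  "gamma_product S \<Gamma> m f g = (\<lambda>a\<in>S.
     if \<exists>b\<in>S. \<exists>\<alpha>\<in>\<Gamma>. \<exists>c\<in>S. a = m b \<alpha> c
     then Sup {min (f b) (g c) | b \<alpha> c. b \<in> S \<and> \<alpha> \<in> \<Gamma> \<and> c \<in> S \<and> a = m b \<alpha> c}
     else 0)"

definition fuzzy_two_sided_ideals ::
  "'s set \<Rightarrow> 'g set \<Rightarrow> ('s \<Rightarrow> 'g \<Rightarrow> 's \<Rightarrow> 's) \<Rightarrow> ('s \<Rightarrow> real) set" where
  "fuzzy_two_sided_ideals S \<Gamma> m =
     {f \<in> fuzzy_subsets S.
        \<forall>x\<in>S. \<forall>\<alpha>\<in>\<Gamma>. \<forall>y\<in>S. f (m x \<alpha> y) \<ge> f y \<and> f (m x \<alpha> y) \<ge> f x}"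

definition fuzzy_ideal_monoid ::
  "'s set \<Rightarrow> 'g set \<Rightarrow> ('s \<Rightarrow> 'g \<Rightarrow> 's \<Rightarrow> 's) \<Rightarrow> ('s \<Rightarrow> real) monoid" where
  "fuzzy_ideal_monoid S \<Gamma> m =
     \<lparr>carrier = fuzzy_two_sided_ideals S \<Gamma> m,
      mult = gamma_product S \<Gamma> m,
      one = fuzzy_whole S\<rparr>"

text \<open>A commutative monoid (including closure of the carrier) with all elements idempotent.\<close>

locale semilattice_monoid = comm_monoid L for L (structure) +
  assumes idem: "f \<in> carrier L \<Longrightarrow> f \<otimes> f = f"

end

theory Submission
  imports Defs
begin

text \<open>
  Intra-regularity lets every \<open>a\<close> be rewritten as
  \<open>a = (x\<beta>(a\<xi>a))\<gamma>y = (a\<beta>(x\<xi>a))\<gamma>y = (y\<beta>(x\<xi>a))\<gamma>a\<close>.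
  The left factor \<open>y\<beta>(x\<xi>a)\<close> is a multiple of \<open>a\<close> and the right factor is \<open>a\<close>, so for
  two-sided ideals \<open>f\<close>, \<open>g\<close> the supremum defining \<open>f \<circ> g\<close> at \<open>a\<close> is attained there with
  value \<open>min (f a) (g a)\<close>. Thus \<open>f \<circ> g\<close> is the pointwise minimum of \<open>f\<close> and \<open>g\<close>.
\<close>

context gamma_AG_star_star_groupoid
begin

lemma intra_regular_factorization:
  assumes "intra_regular S \<Gamma> m" and a: "a \<in> S"
  obtains x y \<beta> \<gamma> \<xi> where "x \<in> S" "y \<in> S" "\<beta> \<in> \<Gamma>" "\<gamma> \<in> \<Gamma>" "\<xi> \<in> \<Gamma>"
    and "a = m (m y \<beta> (m x \<xi> a)) \<gamma> a"
proof -
  obtain x y \<beta> \<gamma> \<xi> where xy: "x \<in> S" "y \<in> S" "\<beta> \<in> \<Gamma>" "\<gamma> \<in> \<Gamma>" "\<xi> \<in> \<Gamma>"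
    and eq: "a = m (m x \<beta> (m a \<xi> a)) \<gamma> y"
    using assms unfolding intra_regular_def by blast
  \<comment> \<open>\<open>star_star\<close> pulls one \<open>a\<close> out of the square to the
    front; \<open>left_invertive\<close> then exchanges that \<open>a\<close> with
    \<open>y\<close>.\<close>
  have "m x \<beta> (m a \<xi> a) = m a \<beta> (m x \<xi> a)"
    using xy a by (intro star_star)
  moreover have "m (m a \<beta> (m x \<xi> a)) \<gamma> y = m (m y \<beta> (m x \<xi> a)) \<gamma> a"
    using xy a by (intro left_invertive m_closed)
  ultimately show thesis
    using that xy eq by simp
qed

lemma gamma_product_ideals_eq_min:
  assumes ir: "intra_regular S \<Gamma> m"
    and f: "f \<in> fuzzy_two_sided_ideals S \<Gamma> m"
    and g: "g \<in> fuzzy_two_sided_ideals S \<Gamma> m"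
  shows "gamma_product S \<Gamma> m f g = (\<lambda>a\<in>S. min (f a) (g a))"
  unfolding gamma_product_def
proof (rule restrict_ext)
  fix a assume a: "a \<in> S"
  have f_left: "f y \<le> f (m x \<alpha> y)" and f_right: "f x \<le> f (m x \<alpha> y)"
    and g_left: "g y \<le> g (m x \<alpha> y)"
    if "x \<in> S" "\<alpha> \<in> \<Gamma>" "y \<in> S" for x \<alpha> y
    using f g that by (auto simp: fuzzy_two_sided_ideals_def)
  let ?V = "{min (f b) (g c) | b \<alpha> c. b \<in> S \<and> \<alpha> \<in> \<Gamma> \<and> c \<in> S \<and> a = m b \<alpha> c}"
  obtain x y \<beta> \<gamma> \<xi> where xy: "x \<in> S" "y \<in> S" "\<beta> \<in> \<Gamma>" "\<gamma> \<in> \<Gamma>" "\<xi> \<in> \<Gamma>"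
    and eq: "a = m (m y \<beta> (m x \<xi> a)) \<gamma> a"
    using intra_regular_factorization[OF ir a] by blast
  define b where "b = m y \<beta> (m x \<xi> a)"
  have b: "b \<in> S" "a = m b \<gamma> a"
    using xy a eq m_closed by (auto simp: b_def)
  \<comment> \<open>\<open>b\<close> arises from \<open>a\<close> by two multiplications from the
    left, so the left ideal inequality is applied twice.\<close>
  have "f a \<le> f (m x \<xi> a)"
    using xy a by (intro f_left)
  also have "\<dots> \<le> f b"
    unfolding b_def using xy a by (intro f_left m_closed)
  finally have "f a \<le> f b" .
  \<comment> \<open>The reverse inequality comes from \<open>a = m b \<gamma> a\<close>. With
    \<open>f b = f a\<close>, the claimed value is itself an element of \<open>?V\<close>, so it
    only remains to bound \<open>?V\<close> by it.\<close>
  moreover have "f b \<le> f a"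
    using f_right[of b \<gamma> a] b xy a by simp
  ultimately have "min (f a) (g a) = min (f b) (g a)"
    by simp
  then have "min (f a) (g a) \<in> ?V"
    using a b xy by blast
  \<comment> \<open>In any factorization of \<open>a\<close>, the right ideal property of
    \<open>f\<close> handles the left factor and the left ideal property of \<open>g\<close> the
    right factor.\<close>
  moreover have "v \<le> min (f a) (g a)" if v: "v \<in> ?V" for v
  proof -
    obtain b \<alpha> c where "v = min (f b) (g c)" "b \<in> S" "\<alpha> \<in> \<Gamma>" "c \<in> S" "a = m b \<alpha> c"
      using v by blast
    then show ?thesis
      using f_right[of b \<alpha> c] g_left[of b \<alpha> c] by (simp add: min.coboundedI1 min.coboundedI2)
  qed
  ultimately have Sup: "Sup ?V = min (f a) (g a)"
    by (rule cSup_eq_maximum)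
  \<comment> \<open>The factorization through \<open>b\<close> also rules out the default value
    0.\<close>
  then show "(if \<exists>b\<in>S. \<exists>\<alpha>\<in>\<Gamma>. \<exists>c\<in>S. a = m b \<alpha> c then Sup ?V else 0) = min (f a) (g a)"
    using a b \<open>\<gamma> \<in> \<Gamma>\<close> by (subst if_P) blast+
qed

end

text \<open>Gives closure of the carrier once products are known to be minima.\<close>

lemma min_fuzzy_two_sided_ideals:
  assumes "f \<in> fuzzy_two_sided_ideals S \<Gamma> m" "g \<in> fuzzy_two_sided_ideals S \<Gamma> m"
    and "\<And>x \<alpha> y. \<lbrakk>x \<in> S; \<alpha> \<in> \<Gamma>; y \<in> S\<rbrakk> \<Longrightarrow> m x \<alpha> y \<in> S"
  shows "(\<lambda>a\<in>S. min (f a) (g a)) \<in> fuzzy_two_sided_ideals S \<Gamma> m"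
  using assms unfolding fuzzy_two_sided_ideals_def fuzzy_subsets_def
  by (auto simp: PiE_iff min_le_iff_disj)

lemma fuzzy_whole_two_sided_ideal:
  assumes "\<And>x \<alpha> y. \<lbrakk>x \<in> S; \<alpha> \<in> \<Gamma>; y \<in> S\<rbrakk> \<Longrightarrow> m x \<alpha> y \<in> S"
  shows "fuzzy_whole S \<in> fuzzy_two_sided_ideals S \<Gamma> m"
  using assms unfolding fuzzy_two_sided_ideals_def fuzzy_subsets_def fuzzy_whole_def
  by auto

theorem theorem5:
  fixes S :: "'s set" and \<Gamma> :: "'g set" and m :: "'s \<Rightarrow> 'g \<Rightarrow> 's \<Rightarrow> 's"
  assumes "gamma_AG_star_star_groupoid S \<Gamma> m"
    and "intra_regular S \<Gamma> m"
  shows "semilattice_monoid (fuzzy_ideal_monoid S \<Gamma> m)"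
proof -
  interpret gamma_AG_star_star_groupoid S \<Gamma> m by fact
  let ?I = "fuzzy_two_sided_ideals S \<Gamma> m"
  let ?meet = "\<lambda>(f :: 's \<Rightarrow> real) g. \<lambda>a\<in>S. min (f a) (g a)"
  note prod = gamma_product_ideals_eq_min[OF assms(2)]
  have meet: "?meet f g \<in> ?I" if "f \<in> ?I" "g \<in> ?I" for f g
    using that m_closed by (rule min_fuzzy_two_sided_ideals)
  have whole: "fuzzy_whole S \<in> ?I"
    using m_closed by (rule fuzzy_whole_two_sided_ideal)
  \<comment> \<open>A meet is restricted to \<open>S\<close>, so it can equal \<open>f\<close> as a
    HOL function only if \<open>f\<close> is extensional; the bound 1 makes
    \<open>fuzzy_whole S\<close> neutral for minima.\<close>
  have ext: "f \<in> extensional S" and le_one: "a \<in> S \<Longrightarrow> f a \<le> 1" if "f \<in> ?I" for f a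
    using that by (auto simp: fuzzy_two_sided_ideals_def fuzzy_subsets_def PiE_iff)
  have idem: "gamma_product S \<Gamma> m f f = f" if "f \<in> ?I" for f
    using ext[OF that] by (simp add: prod that extensional_restrict)
  have unit: "?meet (fuzzy_whole S) f = f" if "f \<in> ?I" for f
    by (rule extensionalityI[OF restrict_extensional ext[OF that]])
      (simp add: fuzzy_whole_def le_one[OF that])
  have "comm_monoid (fuzzy_ideal_monoid S \<Gamma> m)"
  proof (rule comm_monoidI, unfold fuzzy_ideal_monoid_def monoid.simps partial_object.simps)
    fix f g assume fg: "f \<in> ?I" "g \<in> ?I"
    show "gamma_product S \<Gamma> m f g \<in> ?I"
      by (simp only: prod meet fg)
    show "gamma_product S \<Gamma> m f g = gamma_product S \<Gamma> m g f"
      by (simp only: prod fg min.commute)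
    show "gamma_product S \<Gamma> m (fuzzy_whole S) f = f"
      by (simp only: prod whole unit fg)
    fix h assume h: "h \<in> ?I"
    have "?meet (?meet f g) h = ?meet f (?meet g h)"
      by (rule restrict_ext) (simp add: min.assoc)
    \<comment> \<open>\<open>meet\<close> puts the inner minimum back into \<open>?I\<close>, so
      \<open>prod\<close> applies to the outer product as well.\<close>
    then show "gamma_product S \<Gamma> m (gamma_product S \<Gamma> m f g) h =
        gamma_product S \<Gamma> m f (gamma_product S \<Gamma> m g h)"
      by (simp only: prod meet fg h)
  qed (rule whole)
  then show ?thesis
    by (auto intro!: semilattice_monoid.intro semilattice_monoid_axioms.intro
        simp: fuzzy_ideal_monoid_def idem)
qed

end
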